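(* For all $a,b,c>0$ the probability density $g_c(a,b)$ on $\mathbb{R}$ belongs to a determinate Hamburger moment problem; that is, $g_c(a,b)(x)\,dx$ has moments of all orders and is the only positive measure on $\mathbb{R}$ with the moments $\int_{-\infty}^\infty x^n g_c(a,b)(x)\,dx$, $n=0,1,2,\ldots$.
   Context: For $a,b,c>0$, $$e_c(a,b)(t)=\frac{1}{2\pi}\int_{-\infty}^\infty t^{ix-1}[\Gamma(b-iax)/\Gamma(b)]^c\,dx,\quad t>0,$$ which is a probability density on $(0,\infty)$. Here $[\Gamma(z)/\Gamma(b)]^c:=\exp(c\log\Gamma(z)-c\log\Gamma(b))$, where $\log\Gamma$ is the holomorphic branch on $\mathbb{C}\setminus(-\infty,0]$ of the logarithm of $\Gamma$ that is $0$ at $z=1$. The density $g_c(a,b)$ on $\mathbb{R}$ is defined by $$g_c(a,b)(x)=e^{-x}e_c(a,b)(e^{-x}),\quad x\in\mathbb{R}.$$ *)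

theory Defs
  imports "HOL-Probability.Probability"
begin

text \<open>
  On complex numbers \<^const>\<open>ln_Gamma\<close> is the branch of the logarithm of \<open>\<Gamma>\<close> that is
  holomorphic off the nonpositive real axis and vanishes at 1 (it is not \<open>Ln (Gamma z)\<close>).
\<close>

lemma ln_Gamma_branch:
  shows "(ln_Gamma :: complex \<Rightarrow> complex) holomorphic_on (- \<real>\<^sub>\<le>\<^sub>0)"
    and "z \<in> - \<real>\<^sub>\<le>\<^sub>0 \<Longrightarrow> exp (ln_Gamma (z :: complex)) = Gamma z"
    and "ln_Gamma (1 :: complex) = 0"
proof -
  show "(ln_Gamma :: complex \<Rightarrow> complex) holomorphic_on (- \<real>\<^sub>\<le>\<^sub>0)"
    by (rule holomorphic_ln_Gamma) auto
  show "exp (ln_Gamma z) = Gamma z" if "z \<in> - \<real>\<^sub>\<le>\<^sub>0" for z :: complex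
  proof -
    have "z \<notin> \<int>\<^sub>\<le>\<^sub>0" using that nonpos_Ints_subset_nonpos_Reals by blast
    thus ?thesis by (simp add: Gamma_complex_altdef)
  qed
  have "ln_Gamma (of_real 1 :: complex) = of_real (ln_Gamma 1)"
    by (rule ln_Gamma_complex_of_real) simp
  thus "ln_Gamma (1 :: complex) = 0"
    by (simp add: ln_Gamma_real_pos)
qed

definition Gamma_ratio_power :: "real \<Rightarrow> real \<Rightarrow> complex \<Rightarrow> complex" where
  "Gamma_ratio_power c b z = exp (of_real c * ln_Gamma z - of_real c * ln_Gamma (of_real b))"

definition e_integral :: "real \<Rightarrow> real \<Rightarrow> real \<Rightarrow> real \<Rightarrow> complex" where
  "e_integral c a b t =
     1 / (2 * pi) *
     (\<integral>x. of_real t powr (\<i> * of_real x - 1)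
          * Gamma_ratio_power c b (of_real b - \<i> * of_real a * of_real x) \<partial>lborel)"

text \<open>
  Passing to the real part loses nothing: the integral is real, as shown in
  \<open>of_real_e_dens\<close> below.
\<close>

definition e_dens :: "real \<Rightarrow> real \<Rightarrow> real \<Rightarrow> real \<Rightarrow> real" where
  "e_dens c a b t = Re (e_integral c a b t)"

lemma cnj_ln_Gamma:
  assumes "Re z > 0"
  shows "cnj (ln_Gamma z) = ln_Gamma (cnj z)"
proof -
  have nz: "z \<notin> \<int>\<^sub>\<le>\<^sub>0" "cnj z \<notin> \<int>\<^sub>\<le>\<^sub>0"
    using assms by (auto elim!: nonpos_Ints_cases simp: complex_eq_iff)
  have "cnj (ln_Gamma_series z n) = ln_Gamma_series (cnj z) n" if "n > 0" for n
  proof -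
    have "cnj (Ln (z / of_nat k + 1)) = Ln (cnj z / of_nat k + 1)" if "k \<ge> 1" for k
    proof -
      have "Re (z / of_nat k + 1) > 0"
        using assms that by (simp add: add_nonneg_pos)
      hence "z / of_nat k + 1 \<notin> \<real>\<^sub>\<le>\<^sub>0"
        by (auto simp: complex_nonpos_Reals_iff)
      thus ?thesis by (simp add: cnj_Ln)
    qed
    moreover have "cnj (Ln z) = Ln (cnj z)"
      using assms by (subst cnj_Ln) (auto simp: complex_nonpos_Reals_iff)
    moreover have "cnj (Ln (of_nat n)) = Ln (of_nat n)"
      using that by (subst cnj_Ln) (auto simp: complex_nonpos_Reals_iff)
    ultimately show ?thesis
      unfolding ln_Gamma_series_def by (auto simp: cnj_sum intro!: sum.cong)
  qed
  hence ev: "eventually (\<lambda>n. cnj (ln_Gamma_series z n) = ln_Gamma_series (cnj z) n) sequentially"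
    by (intro eventually_mono[OF eventually_gt_at_top[of 0]]) auto
  have "(\<lambda>n. cnj (ln_Gamma_series z n)) \<longlonglongrightarrow> cnj (ln_Gamma z)"
    by (intro tendsto_cnj ln_Gamma_complex_LIMSEQ nz)
  hence "ln_Gamma_series (cnj z) \<longlonglongrightarrow> cnj (ln_Gamma z)"
    by (rule Lim_transform_eventually[OF _ ev])
  thus ?thesis
    using ln_Gamma_complex_LIMSEQ[OF nz(2)] LIMSEQ_unique by blast
qed

lemma of_real_e_dens:
  assumes "b > 0" "t > 0"
  shows "of_real (e_dens c a b t) = e_integral c a b t"
proof -
  define f where "f = (\<lambda>x. of_real t powr (\<i> * of_real x - 1)
          * Gamma_ratio_power c b (of_real b - \<i> * of_real a * of_real x))"
  have "cnj (f x) = f (- x)" for x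
    using assms
    by (simp add: f_def Gamma_ratio_power_def cnj_powr exp_cnj cnj_ln_Gamma)
  hence "cnj (integral\<^sup>L lborel f) = (\<integral>x. f (- x) \<partial>lborel)"
    by (simp only: Bochner_Integration.integral_cnj [symmetric])
  also have "\<dots> = integral\<^sup>L lborel f"
    by (subst (2) lborel_integral_real_affine[where c = "-1" and t = 0]) auto
  finally have "cnj (e_integral c a b t) = e_integral c a b t"
    by (simp add: e_integral_def f_def)
  thus ?thesis
    by (simp add: e_dens_def complex_eq_iff)
qed

definition g_dens :: "real \<Rightarrow> real \<Rightarrow> real \<Rightarrow> real \<Rightarrow> real" where
  "g_dens c a b x = exp (- x) * e_dens c a b (exp (- x))"

definition determinate_Hamburger :: "real measure \<Rightarrow> bool" where
  "determinate_Hamburger \<mu> \<longleftrightarrow>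
     sets \<mu> = sets borel \<and>
     (\<forall>n::nat. integrable \<mu> (\<lambda>x. x ^ n)) \<and>
     (\<forall>\<nu> :: real measure.
        sets \<nu> = sets borel \<longrightarrow>
        (\<forall>n::nat. integrable \<nu> (\<lambda>x. x ^ n) \<and> (\<integral>x. x ^ n \<partial>\<nu>) = (\<integral>x. x ^ n \<partial>\<mu>)) \<longrightarrow>
        \<nu> = \<mu>)"

end

theory Submission
  imports Defs "HOL-Complex_Analysis.Complex_Analysis"
begin

text \<open>
  By Fourier inversion the claim is that \<open>[\<Gamma>(b - iat)/\<Gamma>(b)]\<^sup>c\<close> is the characteristic function of a
  distribution with exponential moments. Euler's product writes it as the limit of
  \<open>n powr (- iact) * (\<Prod>k\<le>n. (1 - iat/(b + k)) powr (- c))\<close>, and each factor is the characteristic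
  function of a scaled gamma distribution of shape \<open>c\<close>. The two-sided Laplace transforms converge
  on the whole strip \<open>|Re z| < b/a\<close>, which gives tightness and, for the weak limit, finite
  exponential moments. Modulus estimates on the factors make the limiting characteristic function
  integrable, so that the Levy inversion formula yields the density. A distribution with
  exponential moments is determined by its moments: any measure with the same moments has the same
  integrals of \<open>cosh (s x)\<close>, hence a Laplace transform holomorphic in the same strip, with the same
  Taylor coefficients at 0.
\<close>

subsection \<open>Laplace transforms and determinacy\<close>

text \<open>Real exponents suffice: the modulus of \<open>exp (z * x)\<close> is
  \<open>exp (Re z * x)\<close>, so this is absolute convergence of the transform on the open strip
  \<open>\<bar>Re z\<bar> < r\<close>. For \<open>r > 0\<close> the case \<open>s = 0\<close> makes
  \<open>M\<close> finite.\<close>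

definition exp_moments :: "real measure \<Rightarrow> real \<Rightarrow> bool" where
  "exp_moments M r \<longleftrightarrow> sets M = sets borel \<and> (\<forall>s. \<bar>s\<bar> < r \<longrightarrow> integrable M (\<lambda>x. exp (s * x)))"

definition laplace :: "real measure \<Rightarrow> complex \<Rightarrow> complex" where
  "laplace M z = (\<integral>x. exp (z * of_real x) \<partial>M)"

lemma exp_momentsD:
  assumes "exp_moments M r"
  shows "sets M = sets borel" "\<bar>s\<bar> < r \<Longrightarrow> integrable M (\<lambda>x. exp (s * x))"
  using assms by (auto simp: exp_moments_def)

lemma exp_moments_mono: "exp_moments M r \<Longrightarrow> r' \<le> r \<Longrightarrow> exp_moments M r'"
  by (auto simp: exp_moments_def)

lemma exp_abs_le: "exp (\<bar>x\<bar>) \<le> exp x + exp (- x)" for x :: real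
  by (cases "x \<ge> 0") auto

lemma laplace_integrable:
  assumes M: "exp_moments M r" and z: "\<bar>Re z\<bar> < r"
  shows "integrable M (\<lambda>x. exp (z * of_real x))"
proof -
  note [measurable_cong] = exp_momentsD(1)[OF M]
  show ?thesis
  proof (rule Bochner_Integration.integrable_bound)
    show "integrable M (\<lambda>x. exp (Re z * x))" using exp_momentsD(2)[OF M z] .
    show "AE x in M. norm (exp (z * of_real x)) \<le> norm (exp (Re z * x))"
      by (simp add: norm_exp_eq_Re)
  qed measurable
qed

text \<open>Expand \<open>exp ((w - z) * x)\<close> under the integral and integrate termwise. The
  terms have absolute sum at most \<open>exp (\<rho> * \<bar>x\<bar>)\<close> with
  \<open>\<rho> = \<bar>Re z\<bar> + norm (w - z) < r\<close>, which is dominated by an integrable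
  function.\<close>

lemma laplace_sums:
  assumes M: "exp_moments M r" and r: "\<bar>Re z\<bar> + norm (w - z) < r"
  shows "(\<lambda>n. (\<integral>x. of_real x ^ n * exp (z * of_real x) / fact n \<partial>M) * (w - z) ^ n) sums laplace M w"
proof -
  note [measurable_cong] = exp_momentsD(1)[OF M]
  define \<rho> where "\<rho> = \<bar>Re z\<bar> + norm (w - z)"
  have \<rho>: "\<rho> \<ge> 0" "\<rho> < r" using r by (auto simp: \<rho>_def)
  define G where "G = (\<lambda>x. exp (\<rho> * x) + exp ((- \<rho>) * x))"
  have intG: "integrable M G"
    unfolding G_def using \<rho> by (intro Bochner_Integration.integrable_add exp_momentsD(2)[OF M]) auto
  define f where "f n x = of_real x ^ n * exp (z * of_real x) / fact n * (w - z) ^ n" for n and x :: real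
  have [measurable]: "f n \<in> borel_measurable M" for n
    unfolding f_def by measurable
  have nf: "norm (f n x) = (\<bar>x\<bar> * norm (w - z)) ^ n /\<^sub>R fact n * exp (Re z * x)" for n x
    by (simp add: f_def norm_mult norm_divide norm_power norm_exp_eq_Re power_mult_distrib divide_inverse norm_inverse)
  have s1: "(\<lambda>n. norm (f n x)) sums (exp (\<bar>x\<bar> * norm (w - z)) * exp (Re z * x))" for x
    unfolding nf by (intro sums_mult2 exp_converges)
  have le: "exp (\<bar>x\<bar> * norm (w - z)) * exp (Re z * x) \<le> G x" for x
  proof -
    have "exp (\<bar>x\<bar> * norm (w - z)) * exp (Re z * x) \<le> exp (\<bar>x\<bar> * norm (w - z)) * exp (\<bar>Re z\<bar> * \<bar>x\<bar>)"
      by (intro mult_left_mono) (auto simp flip: abs_mult)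
    also have "\<dots> = exp \<bar>\<rho> * x\<bar>"
      using \<rho> by (simp add: abs_mult \<rho>_def flip: exp_add) (simp add: algebra_simps)
    also have "\<dots> \<le> G x" using exp_abs_le[of "\<rho> * x"] by (simp add: G_def)
    finally show ?thesis .
  qed
  \<comment> \<open>The bound on partial sums of norms serves twice: it makes each term integrable,
    and it bounds the partial sums of the integrated norms.\<close>
  have part: "(\<Sum>i<n. norm (f i x)) \<le> G x" for n x
    using sum_le_suminf[OF sums_summable[OF s1], of "{..<n}" x] le[of x] sums_unique[OF s1, of x]
    by force
  have intf: "integrable M (f n)" for n
  proof (rule Bochner_Integration.integrable_bound[OF intG])
    have "norm (f n x) \<le> norm (G x)" for x
    proof -
      have "norm (f n x) \<le> (\<Sum>i<Suc n. norm (f i x))"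
        by (simp add: sum_nonneg)
      also have "\<dots> \<le> G x" by (rule part)
      finally show ?thesis by simp
    qed
    thus "AE x in M. norm (f n x) \<le> norm (G x)" by simp
  qed simp
  have sm: "summable (\<lambda>i. \<integral>x. norm (f i x) \<partial>M)"
  proof (rule summableI_nonneg_bounded)
    fix n
    have "(\<Sum>i<n. \<integral>x. norm (f i x) \<partial>M) = (\<integral>x. (\<Sum>i<n. norm (f i x)) \<partial>M)"
      by (rule Bochner_Integration.integral_sum[symmetric]) (auto intro: intf)
    also have "\<dots> \<le> integral\<^sup>L M G"
      by (intro integral_mono part intG Bochner_Integration.integrable_sum integrable_norm intf)
    finally show "(\<Sum>i<n. \<integral>x. norm (f i x) \<partial>M) \<le> integral\<^sup>L M G" .
  qed auto
  have "(\<lambda>i. integral\<^sup>L M (f i)) sums (\<integral>x. (\<Sum>i. f i x) \<partial>M)"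
    by (rule sums_integral[OF intf _ sm]) (auto intro: sums_summable[OF s1])
  also have "(\<lambda>x. \<Sum>i. f i x) = (\<lambda>x. exp (w * of_real x))"
  proof
    fix x :: real
    have "(\<lambda>n. (of_real x * (w - z)) ^ n /\<^sub>R fact n * exp (z * of_real x))
             sums (exp (of_real x * (w - z)) * exp (z * of_real x))"
      by (intro sums_mult2 exp_converges)
    also have "exp (of_real x * (w - z)) * exp (z * of_real x) = exp (w * of_real x)"
      by (simp add: algebra_simps flip: exp_add)
    also have "(\<lambda>n. (of_real x * (w - z)) ^ n /\<^sub>R fact n * exp (z * of_real x)) = (\<lambda>n. f n x)"
      by (auto simp: f_def power_mult_distrib scaleR_conv_of_real divide_inverse)
    finally show "(\<Sum>i. f i x) = exp (w * of_real x)" by (simp add: sums_iff)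
  qed
  also have "(\<lambda>i. integral\<^sup>L M (f i)) = (\<lambda>n. (\<integral>x. of_real x ^ n * exp (z * of_real x) / fact n \<partial>M) * (w - z) ^ n)"
    by (simp add: f_def[abs_def])
  finally show ?thesis unfolding laplace_def .
qed

lemma open_strip: "open {z. \<bar>Re z\<bar> < r}"
  by (intro open_Collect_less continuous_intros)

lemma strip_altdef: "{z. \<bar>Re z\<bar> < r} = {z. Re z > - r} \<inter> {z. Re z < r}"
  by auto

lemma connected_strip: "connected {z. \<bar>Re z\<bar> < r}"
  unfolding strip_altdef
  by (intro convex_connected convex_Int convex_halfspace_Re_gt convex_halfspace_Re_lt)

text \<open>Around \<open>z\<close> the expansion is valid on the ball of radius
  \<open>r - \<bar>Re z\<bar>\<close>, the largest one inside the strip.\<close>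

lemma laplace_holomorphic:
  assumes M: "exp_moments M r"
  shows "laplace M holomorphic_on {z. \<bar>Re z\<bar> < r}"
proof -
  have "laplace M field_differentiable at z" if z: "\<bar>Re z\<bar> < r" for z
  proof -
    have "laplace M holomorphic_on ball z (r - \<bar>Re z\<bar>)"
      by (rule power_series_holomorphic, rule laplace_sums[OF M]) (auto simp: dist_norm norm_minus_commute)
    thus ?thesis using z by (auto simp: holomorphic_on_open field_differentiable_def)
  qed
  thus ?thesis unfolding holomorphic_on_def by (auto intro: field_differentiable_at_within)
qed

lemma char_conv_laplace: "char M t = laplace M (\<i> * of_real t)"
  by (simp add: char_def laplace_def mult.assoc)

section \<open>Moments, and determinacy from exponential moments\<close>

lemma exp_moments_integrable_power:
  assumes M: "exp_moments M r" and r: "r > 0"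
  shows "integrable M (\<lambda>x. x ^ n)"
proof -
  note [measurable_cong] = exp_momentsD(1)[OF M]
  define s where "s = r / 2"
  have s: "s > 0" "s < r" using r by (auto simp: s_def)
  have "integrable M (\<lambda>x. fact n / s ^ n * (exp (s * x) + exp ((- s) * x)))"
    using s by (intro integrable_mult_right Bochner_Integration.integrable_add exp_momentsD(2)[OF M]) auto
  thus ?thesis
  proof (rule Bochner_Integration.integrable_bound)
    have "norm (x ^ n) \<le> norm (fact n / s ^ n * (exp (s * x) + exp ((- s) * x)))" for x
    proof -
      have "(s * \<bar>x\<bar>) ^ n / fact n \<le> exp (s * \<bar>x\<bar>)"
      proof -
        have "(\<lambda>k. (s * \<bar>x\<bar>) ^ k /\<^sub>R fact k) sums exp (s * \<bar>x\<bar>)" by (rule exp_converges)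
        \<comment> \<open>A single term of the exponential series is at most its sum, all terms
          being nonnegative.\<close>
        hence "(\<Sum>k\<in>{n}. (s * \<bar>x\<bar>) ^ k /\<^sub>R fact k) \<le> exp (s * \<bar>x\<bar>)"
          using s by (subst sums_unique[OF exp_converges], intro sum_le_suminf) (auto simp: sums_iff)
        thus ?thesis by (simp add: divide_inverse mult.commute)
      qed
      also have "exp (s * \<bar>x\<bar>) \<le> exp (s * x) + exp ((- s) * x)"
        using exp_abs_le[of "s * x"] s by (simp add: abs_mult)
      finally have "fact n / s ^ n * ((s * \<bar>x\<bar>) ^ n / fact n) \<le> fact n / s ^ n * (exp (s * x) + exp ((- s) * x))"
        using s by (intro mult_left_mono) auto
      thus ?thesis using s by (simp add: power_mult_distrib norm_power power_abs)
    qed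
    thus "AE x in M. norm (x ^ n) \<le> norm (fact n / s ^ n * (exp (s * x) + exp ((- s) * x)))" by simp
  qed measurable
qed

text \<open>The even moments suffice here, since their series sums to the integral of \<open>cosh\<close> without
  any prior integrability.\<close>
lemma exp_moments_transfer:
  assumes M: "exp_moments M r" and r: "r > 0" and N: "sets N = sets borel"
    and mom: "\<And>n. integrable N (\<lambda>x. x ^ n)" "\<And>n. (\<integral>x. x ^ n \<partial>N) = (\<integral>x. x ^ n \<partial>M)"
  shows "exp_moments N r"
  unfolding exp_moments_def
proof (intro conjI allI impI)
  fix s :: real assume s: "\<bar>s\<bar> < r"
  note [measurable_cong] = exp_momentsD(1)[OF M] N
  define h where "h n x = (if even n then (s * x) ^ n /\<^sub>R fact n else 0)" for n and x :: real
  have h0: "h n x \<ge> 0" for n x by (simp add: h_def zero_le_even_power)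
  have hs: "(\<lambda>n. h n x) sums cosh (s * x)" for x
    unfolding h_def by (rule cosh_converges)
  have he: "ennreal (cosh (s * x)) = (\<Sum>n. ennreal (h n x))" for x
    using hs[of x] h0 by (simp add: suminf_ennreal2 sums_iff)
  have [measurable]: "h n \<in> borel_measurable borel" for n unfolding h_def by measurable
  \<comment> \<open>Stated for a general \<open>K\<close> since it is used for both \<open>M\<close>
    and \<open>N\<close>; the integrals of \<open>h n\<close> depend on \<open>K\<close> only
    through its moments.\<close>
  have hi: "integrable K (h n) \<and> (\<integral>x. h n x \<partial>K) = (if even n then s ^ n / fact n * (\<integral>x. x ^ n \<partial>K) else 0)"
    if "\<And>n. integrable K (\<lambda>x. x ^ n)" for K n
  proof (cases "even n")
    case True
    hence "h n = (\<lambda>x. s ^ n / fact n * x ^ n)"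
      by (simp add: h_def power_mult_distrib divide_inverse mult_ac fun_eq_iff)
    thus ?thesis using that True by simp
  next
    case False
    hence "h n = (\<lambda>_. 0)" by (simp add: h_def fun_eq_iff)
    thus ?thesis using False by simp
  qed
  have nn: "(\<integral>\<^sup>+x. cosh (s * x) \<partial>K) = (\<Sum>n. ennreal (\<integral>x. h n x \<partial>K))"
    if "sets K = sets borel" "\<And>n. integrable K (\<lambda>x. x ^ n)" for K
  proof -
    note [measurable_cong] = that(1)
    show ?thesis unfolding he
      by (subst nn_integral_suminf) (auto intro!: arg_cong[where f=suminf] nn_integral_eq_integral h0 hi[THEN conjunct1] that)
  qed
  have "(\<integral>\<^sup>+x. cosh (s * x) \<partial>N) = (\<integral>\<^sup>+x. cosh (s * x) \<partial>M)"
    by (simp add: nn N exp_momentsD(1)[OF M] hi mom exp_moments_integrable_power[OF M r] cong: if_cong)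
  also have "integrable M (\<lambda>x. cosh (s * x))"
    using exp_momentsD(2)[OF M, of s] exp_momentsD(2)[OF M, of "-s"] s
    by (simp add: cosh_def)
  hence "(\<integral>\<^sup>+x. cosh (s * x) \<partial>M) < \<infinity>"
    by (simp add: integrable_iff_bounded)
  finally have "integrable N (\<lambda>x. cosh (s * x))"
    unfolding integrable_iff_bounded cosh_def by simp
  hence "integrable N (\<lambda>x. 2 * cosh (s * x))" by simp
  thus "integrable N (\<lambda>x. exp (s * x))"
    by (rule Bochner_Integration.integrable_bound) (auto simp: cosh_def)
qed (rule N)

text \<open>The moments are, up to factorials, the Taylor coefficients at 0 of the Laplace
  transform. Transforms that agree near 0 agree on the connected strip, hence on the imaginary axis,
  where they are the characteristic functions.\<close>

theorem exp_moments_determinate: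
  assumes M: "exp_moments M r" and r: "r > 0" and "prob_space M"
  shows "determinate_Hamburger M"
  unfolding determinate_Hamburger_def
proof (intro conjI allI impI)
  fix N :: "real measure"
  assume N: "sets N = sets borel"
  assume "\<forall>n. integrable N (\<lambda>x. x ^ n) \<and> (\<integral>x. x ^ n \<partial>N) = (\<integral>x. x ^ n \<partial>M)"
  hence mom: "integrable N (\<lambda>x. x ^ n)" "(\<integral>x. x ^ n \<partial>N) = (\<integral>x. x ^ n \<partial>M)" for n by auto
  note sM = exp_momentsD(1)[OF M]
  interpret M: prob_space M by fact
  have N': "exp_moments N r" by (rule exp_moments_transfer[OF M r N mom])
  \<comment> \<open>The competitor \<open>N\<close> is an arbitrary Borel measure; its moment of
    order 0 makes it finite, and then of total mass 1.\<close>
  interpret N: finite_measure N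
    using mom(1)[of 0] sets_eq_imp_space_eq[OF N]
    by (intro finite_measureI) (auto simp: integrable_iff_bounded less_top[symmetric])
  have "measure N (space N) = 1" using mom(2)[of 0] M.prob_space by simp
  hence "emeasure N (space N) = 1" by (simp add: N.emeasure_eq_measure)
  then interpret N: prob_space N by (rule prob_spaceI)
  have rM: "real_distribution M" "real_distribution N"
    by (unfold_locales; simp add: sM N)+
  have "laplace N z = laplace M z" if z: "\<bar>Re z\<bar> < r" for z
  proof (rule analytic_continuation_open[of "ball 0 r" "{z. \<bar>Re z\<bar> < r}" "laplace N" "laplace M"])
    show "ball 0 r \<subseteq> {z. \<bar>Re z\<bar> < r}"
      by (auto intro: le_less_trans[OF abs_Re_le_cmod])
    show "laplace N w = laplace M w" if w: "w \<in> ball 0 r" for w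
    proof -
      have pw: "(\<lambda>n. of_real (\<integral>x. x ^ n \<partial>K) / fact n * w ^ n) sums laplace K w" if K: "exp_moments K r" for K
      proof -
        have "(\<lambda>n. (\<integral>x. of_real x ^ n * exp (0 * of_real x) / fact n \<partial>K) * (w - 0) ^ n) sums laplace K w"
          using w by (intro laplace_sums[OF K]) auto
        thus ?thesis by (simp flip: of_real_power)
      qed
      show ?thesis
        using pw[OF N'] pw[OF M] by (simp add: mom(2) sums_unique2)
    qed
  qed (use that r in \<open>auto intro!: open_strip connected_strip laplace_holomorphic M N'\<close>)
  hence "char N = char M" using r by (auto simp: char_conv_laplace)
  thus "N = M" by (intro Levy_uniqueness rM)
qed (rule exp_momentsD(1)[OF M] exp_moments_integrable_power[OF M r])+

subsection \<open>Gamma distributions and their convolutions\<close>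

text \<open>Bundles the law, its strip of convergence and a closed form \<open>F\<close>, of which
  only the values in the strip matter. Scaling and convolution act on this triple.\<close>

definition has_laplace :: "real measure \<Rightarrow> real \<Rightarrow> (complex \<Rightarrow> complex) \<Rightarrow> bool" where
  "has_laplace M r F \<longleftrightarrow>
     real_distribution M \<and> exp_moments M r \<and> (\<forall>z. \<bar>Re z\<bar> < r \<longrightarrow> laplace M z = F z)"

lemma has_laplaceI:
  assumes "real_distribution M"
    and "\<And>s. \<bar>s\<bar> < r \<Longrightarrow> integrable M (\<lambda>x. exp (s * x))"
    and "\<And>z. \<bar>Re z\<bar> < r \<Longrightarrow> laplace M z = F z"
  shows "has_laplace M r F"
  using assms by (auto simp: has_laplace_def exp_moments_def real_distribution.events_eq_borel)

lemma has_laplaceD: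
  assumes "has_laplace M r F"
  shows "real_distribution M" "exp_moments M r" "\<bar>Re z\<bar> < r \<Longrightarrow> laplace M z = F z"
  using assms by (auto simp: has_laplace_def)

lemma has_laplace_mono: "has_laplace M r F \<Longrightarrow> r' \<le> r \<Longrightarrow> has_laplace M r' F"
  by (auto simp: has_laplace_def intro: exp_moments_mono)

lemma has_laplace_return: "has_laplace (return borel m) r (\<lambda>z. exp (z * of_real m))"
proof (rule has_laplaceI)
  interpret prob_space "return borel m" by (rule prob_space_return) simp
  show "real_distribution (return borel m)" by unfold_locales simp
  show "integrable (return borel m) (\<lambda>x. exp (s * x))" for s
    by (rule integrableI_bounded) (simp_all add: nn_integral_return)
  show "laplace (return borel m) z = exp (z * of_real m)" for z
    unfolding laplace_def by (subst integral_return) simp_all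
qed

lemma has_laplace_scale:
  assumes M: "has_laplace M r F" and \<theta>: "\<theta> > 0"
  shows "has_laplace (distr M borel (\<lambda>x. \<theta> * x)) (r / \<theta>) (\<lambda>z. F (of_real \<theta> * z))"
proof (rule has_laplaceI)
  interpret real_distribution M by (rule has_laplaceD(1)[OF M])
  show "real_distribution (distr M borel (\<lambda>x. \<theta> * x))" by (rule real_distribution_distr) measurable
  have *: "\<bar>\<theta> * s\<bar> < r" if "\<bar>s\<bar> < r / \<theta>" for s
    using that \<theta> by (simp add: abs_mult field_simps)
  show "integrable (distr M borel (\<lambda>x. \<theta> * x)) (\<lambda>x. exp (s * x))" if "\<bar>s\<bar> < r / \<theta>" for s
    using exp_momentsD(2)[OF has_laplaceD(2)[OF M] *[OF that]]
    by (subst integrable_distr_eq) (simp_all add: mult_ac)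
  show "laplace (distr M borel (\<lambda>x. \<theta> * x)) z = F (of_real \<theta> * z)" if "\<bar>Re z\<bar> < r / \<theta>" for z
    using has_laplaceD(3)[OF M, of "of_real \<theta> * z"] *[OF that]
    unfolding laplace_def by (subst integral_distr) (simp_all add: mult_ac)
qed

text \<open>The norm of the product factorizes, so the iterated integral of norms is a constant
  multiple of the integral of \<open>norm (f x)\<close>.\<close>

lemma (in pair_sigma_finite) integrable_mult_pair:
  fixes f g :: "_ \<Rightarrow> 'c::{real_normed_field, banach, second_countable_topology}"
  assumes f: "integrable M1 f" and g: "integrable M2 g"
  shows "integrable (M1 \<Otimes>\<^sub>M M2) (\<lambda>(x, y). f x * g y)"
proof -
  note [measurable] = borel_measurable_integrable[OF f] borel_measurable_integrable[OF g]
  show ?thesis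
  proof (rule Fubini_integrable)
    show "integrable M1 (\<lambda>x. \<integral>y. norm (case (x, y) of (x, y) \<Rightarrow> f x * g y) \<partial>M2)"
      using f by (simp add: norm_mult)
    show "AE x in M1. integrable M2 (\<lambda>y. case (x, y) of (x, y) \<Rightarrow> f x * g y)"
      using g by simp
  qed measurable
qed

text \<open>\<open>exp (z * (x + y))\<close> splits into a product, and Fubini separates the two
  integrals.\<close>

lemma has_laplace_convolution:
  assumes M: "has_laplace M r F" and N: "has_laplace N r G"
  shows "has_laplace (M \<star> N) r (\<lambda>z. F z * G z)"
proof (rule has_laplaceI)
  interpret M: real_distribution M by (rule has_laplaceD(1)[OF M])
  interpret N: real_distribution N by (rule has_laplaceD(1)[OF N])
  interpret pair_prob_space M N ..
  have [measurable]: "(\<lambda>(x, y). x + y) \<in> borel_measurable (M \<Otimes>\<^sub>M N)" by measurable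
  show "real_distribution (M \<star> N)"
    unfolding convolution_def by (rule P.real_distribution_distr) measurable
  show "integrable (M \<star> N) (\<lambda>x. exp (s * x))" if s: "\<bar>s\<bar> < r" for s
    using integrable_mult_pair[OF exp_momentsD(2)[OF has_laplaceD(2)[OF M] s] exp_momentsD(2)[OF has_laplaceD(2)[OF N] s]]
    unfolding convolution_def
    by (subst integrable_distr_eq) (simp_all add: case_prod_unfold distrib_left exp_add)
  show "laplace (M \<star> N) z = F z * G z" if z: "\<bar>Re z\<bar> < r" for z
  proof -
    have i: "integrable M (\<lambda>x. exp (z * of_real x))" "integrable N (\<lambda>x. exp (z * of_real x))"
      using z M N by (auto intro: laplace_integrable has_laplaceD(2))
    have "laplace (M \<star> N) z = (\<integral>p. (case p of (x, y) \<Rightarrow> exp (z * of_real x) * exp (z * of_real y)) \<partial>(M \<Otimes>\<^sub>M N))"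
      unfolding laplace_def convolution_def
      by (subst integral_distr) (simp_all add: case_prod_unfold distrib_left exp_add)
    also have "\<dots> = (\<integral>x. (\<integral>y. exp (z * of_real x) * exp (z * of_real y) \<partial>N) \<partial>M)"
      by (subst integral_fst'[OF integrable_mult_pair[OF i], symmetric]) simp
    also have "\<dots> = laplace M z * laplace N z"
      unfolding laplace_def by simp
    finally show ?thesis using z by (simp add: has_laplaceD(3)[OF M] has_laplaceD(3)[OF N])
  qed
qed

text \<open>Shape \<open>c\<close> and rate 1, with the integrand written in the form of Euler's
  integral for \<open>Gamma c\<close>.\<close>

definition gamma_distribution :: "real \<Rightarrow> real measure" where
  "gamma_distribution c = density lborel (\<lambda>x. ennreal (indicator {0..} x * x powr (c - 1) / exp x / Gamma c))"

text \<open>Rescale Euler's integral for \<open>Gamma c\<close> by the factor \<open>1 - s\<close>.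
  With nonnegative integrals this yields finiteness along with the value.\<close>

lemma nn_integral_gamma_distribution_exp:
  assumes c: "c > 0" and s: "s < 1"
  shows "(\<integral>\<^sup>+x. ennreal (exp (s * x)) \<partial>gamma_distribution c) = ennreal ((1 - s) powr (- c))"
proof -
  define h where "h x = indicator {0..} x * x powr (c - 1) / exp x" for x :: real
  have [measurable]: "h \<in> borel_measurable borel" unfolding h_def by measurable
  have h0: "h x \<ge> 0" for x by (simp add: h_def)
  have G: "Gamma c > 0" using c by (rule Gamma_real_pos)
  have d: "1 - s > 0" using s by simp
  have "ennreal (Gamma c) = (\<integral>\<^sup>+x. ennreal (h x) \<partial>lborel)"
    unfolding h_def by (rule Gamma_conv_nn_integral_real[OF c])
  also have "\<dots> = ennreal \<bar>1 - s\<bar> * (\<integral>\<^sup>+x. ennreal (h (0 + (1 - s) * x)) \<partial>lborel)"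
    using s by (intro nn_integral_real_affine) auto
  also have "(\<lambda>x. h (0 + (1 - s) * x)) = (\<lambda>x. (1 - s) powr (c - 1) * Gamma c * (h x / Gamma c * exp (s * x)))"
  proof
    fix x
    show "h (0 + (1 - s) * x) = (1 - s) powr (c - 1) * Gamma c * (h x / Gamma c * exp (s * x))"
    proof (cases "x \<ge> 0")
      case True
      have e: "exp ((1 - s) * x) = exp x / exp (s * x)"
        by (simp add: left_diff_distrib exp_diff)
      show ?thesis using True d G by (simp add: h_def powr_mult e zero_le_mult_iff)
    next
      case False
      thus ?thesis using d by (simp add: h_def indicator_def zero_le_mult_iff)
    qed
  qed
  also have "(\<integral>\<^sup>+x. ennreal ((1 - s) powr (c - 1) * Gamma c * (h x / Gamma c * exp (s * x))) \<partial>lborel) =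
     ennreal ((1 - s) powr (c - 1) * Gamma c) * (\<integral>\<^sup>+x. ennreal (h x / Gamma c * exp (s * x)) \<partial>lborel)"
  proof -
    define A where "A = (1 - s) powr (c - 1) * Gamma c"
    have "A \<ge> 0" using G by (simp add: A_def)
    thus ?thesis unfolding A_def[symmetric] by (simp only: ennreal_mult') (rule nn_integral_cmult, measurable)
  qed
  also have "(\<integral>\<^sup>+x. ennreal (h x / Gamma c * exp (s * x)) \<partial>lborel) = (\<integral>\<^sup>+x. ennreal (exp (s * x)) \<partial>gamma_distribution c)"
    unfolding gamma_distribution_def h_def[symmetric] using h0 G
    by (subst nn_integral_density) (auto intro!: nn_integral_cong simp flip: ennreal_mult)
  finally have "ennreal (Gamma c) = ennreal \<bar>1 - s\<bar> * (ennreal ((1 - s) powr (c - 1) * Gamma c) *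
      (\<integral>\<^sup>+x. ennreal (exp (s * x)) \<partial>gamma_distribution c))" .
  also have "\<dots> = ennreal (\<bar>1 - s\<bar> * ((1 - s) powr (c - 1) * Gamma c)) *
      (\<integral>\<^sup>+x. ennreal (exp (s * x)) \<partial>gamma_distribution c)"
    by (subst (2) ennreal_mult') (simp_all add: mult.assoc)
  also have "\<bar>1 - s\<bar> * ((1 - s) powr (c - 1) * Gamma c) = (1 - s) powr c * Gamma c"
    using d by (simp add: powr_diff)
  \<comment> \<open>The Jacobian \<open>1 - s\<close> and the power
    \<open>(1 - s) powr (c - 1)\<close> from the density have combined to
    \<open>(1 - s) powr c\<close>; this positive finite factor is cancelled at the end.\<close>
  finally have "ennreal ((1 - s) powr c * Gamma c) * (\<integral>\<^sup>+x. ennreal (exp (s * x)) \<partial>gamma_distribution c)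
      = ennreal (Gamma c)" ..
  also have "ennreal (Gamma c) = ennreal ((1 - s) powr c * Gamma c * (1 - s) powr (- c))"
    using d by (simp add: powr_minus_divide)
  also have "\<dots> = ennreal ((1 - s) powr c * Gamma c) * ennreal ((1 - s) powr (- c))"
    using G by (intro ennreal_mult) auto
  finally show ?thesis
    using d G by (subst (asm) ennreal_mult_cancel_left) auto
qed

text \<open>For real arguments the formula is the preceding integral. Both sides are holomorphic in
  the strip, where \<open>1 - z\<close> has positive real part and so avoids the cut of the
  principal power; the identity theorem extends the formula from the real segment.\<close>

lemma has_laplace_gamma_distribution:
  assumes c: "c > 0"
  shows "has_laplace (gamma_distribution c) 1 (\<lambda>z. (1 - z) powr (- of_real c))"
proof -
  let ?M = "gamma_distribution c"
  have [measurable_cong, simp]: "sets ?M = sets borel" by (simp add: gamma_distribution_def)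
  interpret prob_space ?M
    using nn_integral_gamma_distribution_exp[OF c, of 0]
    by (intro prob_spaceI) (simp add: gamma_distribution_def emeasure_density)
  have I: "integrable ?M (\<lambda>x. exp (s * x)) \<and> (\<integral>x. exp (s * x) \<partial>?M) = (1 - s) powr (- c)" if "s < 1" for s
    using nn_integral_gamma_distribution_exp[OF c that]
    by (subst nn_integral_eq_integrable[symmetric]) auto
  have E: "exp_moments ?M 1"
    using I by (auto simp: exp_moments_def)
  have "laplace ?M z - (1 - z) powr (- of_real c) = 0" if z: "\<bar>Re z\<bar> < 1" for z
  proof (rule analytic_continuation[where f = "\<lambda>z. laplace ?M z - (1 - z) powr (- of_real c)"
        and S = "{z. \<bar>Re z\<bar> < 1}" and U = "complex_of_real ` {-1<..<1}" and \<xi> = 0])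
    show "(\<lambda>z. laplace ?M z - (1 - z) powr (- of_real c)) holomorphic_on {z. \<bar>Re z\<bar> < 1}"
      by (intro holomorphic_intros laplace_holomorphic E) (auto simp: complex_nonpos_Reals_iff)
    show "0 islimpt complex_of_real ` {-1<..<1}"
      unfolding islimpt_approachable
    proof (intro allI impI)
      fix e :: real assume e: "e > 0"
      show "\<exists>x'\<in>complex_of_real ` {-1<..<1}. x' \<noteq> 0 \<and> dist x' 0 < e"
        using e by (intro bexI[of _ "complex_of_real (min (e / 2) (1 / 2))"]) auto
    qed
    fix w assume "w \<in> complex_of_real ` {-1<..<1}"
    then obtain s where s: "w = of_real s" "-1 < s" "s < 1" by auto
    have "laplace ?M w = of_real (\<integral>x. exp (s * x) \<partial>?M)"
      by (simp add: laplace_def s exp_of_real flip: of_real_mult)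
    also have "\<dots> = (1 - w) powr (- of_real c)"
      using I[OF s(3)] s(3) powr_of_real[of "1 - s" "- c"] by (simp add: s(1))
    finally show "laplace ?M w - (1 - w) powr (- of_real c) = 0" by simp
  qed (use z in \<open>auto intro: open_strip connected_strip\<close>)
  moreover have "real_distribution ?M" by unfold_locales simp
  ultimately show ?thesis using E by (auto simp: has_laplace_def)
qed

text \<open>The law is the convolution of a point mass at \<open>m\<close> with \<open>n\<close>
  gamma laws. Scaling by \<open>1 / \<beta> k\<close> moves the singularity from 1 to
  \<open>\<beta> k \<ge> r\<close>, so all factors share the strip of width parameter
  \<open>r\<close>.\<close>

lemma ex_has_laplace_prod:
  fixes \<beta> :: "nat \<Rightarrow> real"
  assumes c: "c > 0" and r: "r > 0" and \<beta>: "\<And>k. \<beta> k \<ge> r"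
  shows "\<exists>M. has_laplace M r (\<lambda>z. exp (z * of_real m) * (\<Prod>k<n. (1 - z / of_real (\<beta> k)) powr (- of_real c)))"
proof (induction n)
  case 0
  thus ?case using has_laplace_return[of m r] by auto
next
  case (Suc n)
  then obtain M where M: "has_laplace M r (\<lambda>z. exp (z * of_real m) * (\<Prod>k<n. (1 - z / of_real (\<beta> k)) powr (- of_real c)))"
    by blast
  have \<beta>n: "\<beta> n > 0" "r \<le> \<beta> n" using \<beta>[of n] r by auto
  have "has_laplace (distr (gamma_distribution c) borel (\<lambda>x. 1 / \<beta> n * x)) (1 / (1 / \<beta> n))
              (\<lambda>z. (1 - of_real (1 / \<beta> n) * z) powr (- of_real c))"
    using \<beta>n by (intro has_laplace_scale[OF has_laplace_gamma_distribution[OF c]]) simp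
  hence N: "has_laplace (distr (gamma_distribution c) borel (\<lambda>x. 1 / \<beta> n * x)) r
              (\<lambda>z. (1 - of_real (1 / \<beta> n) * z) powr (- of_real c))"
    by (rule has_laplace_mono) (use \<beta>n in simp)
  have eq: "(\<lambda>z::complex. exp (z * of_real m) * (\<Prod>k<n. (1 - z / of_real (\<beta> k)) powr (- of_real c)) *
              (1 - of_real (1 / \<beta> n) * z) powr (- of_real c)) =
            (\<lambda>z. exp (z * of_real m) * (\<Prod>k<Suc n. (1 - z / of_real (\<beta> k)) powr (- of_real c)))"
    by (simp add: mult.assoc fun_eq_iff divide_inverse mult.commute)
  show ?case using has_laplace_convolution[OF M N] unfolding eq by (rule exI)
qed

subsection \<open>Weak limits under bounded exponential moments\<close>

text \<open>Markov's inequality for \<open>exp (s * x) + exp (- s * x)\<close>, which is at least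
  \<open>exp (s * K)\<close> wherever \<open>\<bar>x\<bar> \<ge> K\<close>.\<close>

lemma exp_moments_tight:
  assumes M: "\<And>n. real_distribution (M n)" "\<And>n. exp_moments (M n) r" and r: "r > 0"
    and B: "\<And>s n. \<bar>s\<bar> < r \<Longrightarrow> (\<integral>x. exp (s * x) \<partial>M n) \<le> B s"
  shows "tight M"
  unfolding tight_def
proof (intro conjI allI impI)
  fix \<epsilon> :: real assume \<epsilon>: "\<epsilon> > 0"
  define s where "s = r / 2"
  have s: "s > 0" "\<bar>s\<bar> < r" "\<bar>- s\<bar> < r" using r by (auto simp: s_def)
  \<comment> \<open>This bounds the integral of the Markov function uniformly in \<open>n\<close>;
    below, \<open>\<bar>C\<bar>\<close> spares a separate proof that \<open>C\<close> is
    nonnegative.\<close>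
  define C where "C = B s + B (- s)"
  obtain K where K: "K > 0" "\<bar>C\<bar> / exp (s * K) < \<epsilon>"
  proof -
    have "((\<lambda>K. \<bar>C\<bar> / exp (s * K)) \<longlongrightarrow> 0) at_top" using s(1) by real_asymp
    hence "eventually (\<lambda>K. \<bar>C\<bar> / exp (s * K) < \<epsilon>) at_top"
      using \<epsilon> by (auto dest: order_tendstoD)
    hence "eventually (\<lambda>K. K > 0 \<and> \<bar>C\<bar> / exp (s * K) < \<epsilon>) at_top"
      using eventually_gt_at_top[of 0] by eventually_elim auto
    thus ?thesis using that by (auto dest: eventually_happens)
  qed
  show "\<exists>a b. a < b \<and> (\<forall>n. 1 - \<epsilon> < measure (M n) {a<..b})"
  proof (rule exI[of _ "- K"], rule exI[of _ K], intro conjI allI)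
    show "- K < K" using K by simp
    fix n
    interpret real_distribution "M n" by (rule M)
    define u where "u x = exp (s * x) + exp ((- s) * x)" for x
    have int: "integrable (M n) u"
      unfolding u_def using s by (intro Bochner_Integration.integrable_add exp_momentsD(2)[OF M(2)]) auto
    have "prob (UNIV - {-K<..K}) \<le> prob {x \<in> space (M n). u x \<ge> exp (s * K)}"
    proof (rule finite_measure_mono)
      show "{x \<in> space (M n). u x \<ge> exp (s * K)} \<in> events"
        unfolding u_def by measurable
      show "UNIV - {-K<..K} \<subseteq> {x \<in> space (M n). u x \<ge> exp (s * K)}"
      proof
        fix x assume "x \<in> UNIV - {-K<..K}"
        hence "K \<le> x \<or> K \<le> - x" by auto
        hence "s * K \<le> s * x \<or> s * K \<le> s * (- x)"
          using s(1) by (meson mult_left_mono less_imp_le)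
        hence "s * K \<le> s * x \<or> s * K \<le> (- s) * x" by simp
        hence "exp (s * K) \<le> exp (s * x) \<or> exp (s * K) \<le> exp ((- s) * x)" by auto
        hence "exp (s * K) \<le> u x" unfolding u_def
          using exp_ge_zero[of "s * x"] exp_ge_zero[of "(- s) * x"] by linarith
        thus "x \<in> {x \<in> space (M n). u x \<ge> exp (s * K)}" by simp
      qed
    qed
    also have "\<dots> \<le> (\<integral>x. u x \<partial>M n) / exp (s * K)"
      by (rule integral_Markov_inequality_measure[OF int, of "{}"]) (auto simp: u_def)
    also have "(\<integral>x. u x \<partial>M n) = (\<integral>x. exp (s * x) \<partial>M n) + (\<integral>x. exp ((- s) * x) \<partial>M n)"
      unfolding u_def using s by (intro Bochner_Integration.integral_add exp_momentsD(2)[OF M(2)]) auto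
    also have "\<dots> \<le> C"
      unfolding C_def using s by (intro add_mono B) auto
    also have "C / exp (s * K) \<le> \<bar>C\<bar> / exp (s * K)" by (simp add: divide_right_mono)
    also have "\<dots> < \<epsilon>" by (rule K)
    finally have "prob (UNIV - {-K<..K}) < \<epsilon>" by (simp add: divide_right_mono)
    moreover have "prob (UNIV - {-K<..K}) = 1 - prob {-K<..K}"
      using prob_compl[of "{-K<..K}"] by simp
    ultimately show "1 - \<epsilon> < prob {-K<..K}" by simp
  qed
qed (rule M)

text \<open>\<open>exp (s * x)\<close> is unbounded, so weak convergence does not apply to it
  directly. The truncations at \<open>k\<close> are bounded and continuous and inherit the bound
  \<open>B s\<close>; monotone convergence in \<open>k\<close> then gives integrability.\<close>

lemma exp_moments_weak_limit:
  assumes M: "\<And>n. real_distribution (M n)" "\<And>n. exp_moments (M n) r"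
    and B: "\<And>s n. \<bar>s\<bar> < r \<Longrightarrow> (\<integral>x. exp (s * x) \<partial>M n) \<le> B s"
    and L: "real_distribution L" "weak_conv_m M L"
  shows "exp_moments L r"
  unfolding exp_moments_def
proof (intro conjI allI impI)
  interpret L: real_distribution L by (rule L)
  show "sets L = sets borel" by simp
  fix s :: real assume s: "\<bar>s\<bar> < r"
  define f where "f k x = min (exp (s * x)) (real k)" for k :: nat and x :: real
  have fb: "norm (f k x) \<le> real k" for k x by (auto simp: f_def)
  have fc: "isCont (f k) x" for k x unfolding f_def by (intro continuous_intros)
  have [measurable]: "f k \<in> borel_measurable borel" for k unfolding f_def by measurable
  have int: "integrable L (f k)" for k
    by (rule L.integrable_const_bound[of _ "real k"]) (use fb in auto)
  have le: "(\<integral>x. f k x \<partial>L) \<le> B s" for k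
  proof (rule LIMSEQ_le_const2)
    show "(\<lambda>n. \<integral>x. f k x \<partial>M n) \<longlonglongrightarrow> (\<integral>x. f k x \<partial>L)"
      by (rule weak_conv_imp_integral_bdd_continuous_conv[OF M(1) L fc fb])
    have "(\<integral>x. f k x \<partial>M n) \<le> B s" for n
    proof -
      interpret real_distribution "M n" by (rule M)
      have "(\<integral>x. f k x \<partial>M n) \<le> (\<integral>x. exp (s * x) \<partial>M n)"
      proof (rule integral_mono)
        show "integrable (M n) (f k)"
          by (rule integrable_const_bound[of _ "real k"]) (use fb in auto)
      qed (auto simp: f_def intro: exp_momentsD(2)[OF M(2) s])
      also have "\<dots> \<le> B s" by (rule B[OF s])
      finally show ?thesis .
    qed
    thus "\<exists>N. \<forall>n\<ge>N. (\<integral>x. f k x \<partial>M n) \<le> B s" by blast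
  qed
  have mono: "f k x \<le> f l x" if "k \<le> l" for k l x using that by (auto simp: f_def)
  have inc: "incseq (\<lambda>k. \<integral>x. f k x \<partial>L)"
    by (intro incseq_SucI integral_mono int mono) auto
  obtain l where l: "(\<lambda>k. \<integral>x. f k x \<partial>L) \<longlonglongrightarrow> l"
    by (rule incseq_convergent[OF inc, of "B s"]) (use le in auto)
  show "integrable L (\<lambda>x. exp (s * x))"
  proof (rule integrable_monotone_convergence[OF int _ _ l])
    show "AE x in L. mono (\<lambda>n. f n x)" by (auto intro!: monoI mono)
    have "(\<lambda>n. f n x) \<longlonglongrightarrow> exp (s * x)" for x
    proof (rule tendsto_eventually)
      have "eventually (\<lambda>k. real k \<ge> exp (s * x)) sequentially"
        by real_asymp
      thus "eventually (\<lambda>k. f k x = exp (s * x)) sequentially"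
        by eventually_elim (auto simp: f_def)
    qed
    thus "AE x in L. (\<lambda>n. f n x) \<longlonglongrightarrow> exp (s * x)" by simp
  qed measurable
qed

text \<open>Convergence at real \<open>s\<close> bounds the exponential moments uniformly, which
  gives tightness. A weakly convergent subsequence is enough, since convergence on the imaginary
  axis prescribes the characteristic function of its limit.\<close>

lemma laplace_limit:
  assumes M: "\<And>n. real_distribution (M n)" "\<And>n. exp_moments (M n) r" and r: "r > 0"
    and lim: "\<And>z. \<bar>Re z\<bar> < r \<Longrightarrow> (\<lambda>n. laplace (M n) z) \<longlonglongrightarrow> G z"
  obtains L where "real_distribution L" "exp_moments L r" "\<And>t. char L t = G (\<i> * of_real t)"
proof -
  have "\<exists>B. \<forall>n. (\<integral>x. exp (s * x) \<partial>M n) \<le> B" if s: "\<bar>s\<bar> < r" for s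
  proof -
    have "Bseq (\<lambda>n. laplace (M n) (of_real s))"
      using lim[of "of_real s"] s by (intro convergent_imp_Bseq convergentI) auto
    then obtain B where B: "\<And>n. norm (laplace (M n) (of_real s)) \<le> B"
      by (auto simp: Bseq_def)
    have "laplace (M n) (of_real s) = of_real (\<integral>x. exp (s * x) \<partial>M n)" for n
      by (simp add: laplace_def exp_of_real flip: of_real_mult)
    hence "(\<integral>x. exp (s * x) \<partial>M n) \<le> B" for n
      using B[of n] by (simp add: abs_le_iff)
    thus ?thesis by blast
  qed
  then obtain B where B: "\<And>s n. \<bar>s\<bar> < r \<Longrightarrow> (\<integral>x. exp (s * x) \<partial>M n) \<le> B s"
    by metis
  have "tight M" by (rule exp_moments_tight[OF M r B])
  then obtain \<sigma> L where L: "strict_mono \<sigma>" "real_distribution L" "weak_conv_m (M \<circ> id \<circ> \<sigma>) L"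
    using tight_imp_convergent_subsubsequence[OF _ strict_mono_id] by blast
  have L': "weak_conv_m (\<lambda>n. M (\<sigma> n)) L" using L(3) by (simp add: o_def)
  have "exp_moments L r"
    by (rule exp_moments_weak_limit[OF M B L(2) L'])
  moreover have "char L t = G (\<i> * of_real t)" for t
  proof (rule LIMSEQ_unique)
    show "(\<lambda>n. char (M (\<sigma> n)) t) \<longlonglongrightarrow> char L t"
      by (rule levy_continuity1[OF M(1) L(2) L'])
    show "(\<lambda>n. char (M (\<sigma> n)) t) \<longlonglongrightarrow> G (\<i> * of_real t)"
      using LIMSEQ_subseq_LIMSEQ[OF lim[of "\<i> * of_real t"] L(1)] r
      by (simp add: char_conv_laplace o_def)
  qed
  ultimately show ?thesis using that L(2) by blast
qed

subsection \<open>Densities from integrable characteristic functions\<close>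

text \<open>Dominated convergence along sequences, with majorant
  \<open>norm (\<phi> t)\<close>.\<close>

lemma isCont_fourier:
  fixes \<phi> :: "real \<Rightarrow> complex"
  assumes \<phi>: "integrable lborel \<phi>"
  shows "isCont (\<lambda>x. CLBINT t. iexp (- (t * x)) * \<phi> t) x"
  unfolding continuous_at_sequentially
proof safe
  fix X assume X: "X \<longlonglongrightarrow> x"
  note [measurable] = borel_measurable_integrable[OF \<phi>]
  show "((\<lambda>x. CLBINT t. iexp (- (t * x)) * \<phi> t) \<circ> X) \<longlonglongrightarrow> (CLBINT t. iexp (- (t * x)) * \<phi> t)"
    unfolding o_def
  proof (rule integral_dominated_convergence[where w = "\<lambda>t. norm (\<phi> t)"])
    show "AE t in lborel. (\<lambda>n. iexp (- (t * X n)) * \<phi> t) \<longlonglongrightarrow> iexp (- (t * x)) * \<phi> t"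
      using X by (auto intro!: tendsto_intros)
  qed (use \<phi> in \<open>auto simp: norm_mult\<close>)
qed

lemma norm_fourier_le:
  fixes \<phi> :: "real \<Rightarrow> complex"
  shows "norm (CLBINT t. iexp (- (t * x)) * \<phi> t) \<le> (LBINT t. norm (\<phi> t))"
  using integral_norm_bound[of lborel "\<lambda>t. iexp (- (t * x)) * \<phi> t"] by (simp add: norm_mult)

text \<open>Writes the kernel of Levy's inversion formula as an integral over \<open>{a..b}\<close>,
  so that Fubini can later expose a density.\<close>

lemma integral_iexp_Icc:
  fixes a b t :: real
  assumes "a \<le> b" "t \<noteq> 0"
  shows "(CLBINT x. indicator {a..b} x *\<^sub>R iexp (- (t * x))) = (iexp (- (t * a)) - iexp (- (t * b))) / (\<i> * t)"
proof -
  define F where "F = (\<lambda>x. - (exp (- \<i> * of_real t * of_real x) / (\<i> * of_real t)))"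
  have "(CLBINT x. indicator {a..b} x *\<^sub>R iexp (- (t * x))) = F b - F a"
  proof (rule integral_FTC_Icc[OF assms(1)])
    fix x
    have "((\<lambda>z. - (exp (- \<i> * of_real t * z) / (\<i> * of_real t))) has_field_derivative iexp (- (t * x))) (at (of_real x))"
      using assms(2) by (auto intro!: derivative_eq_intros simp: mult.assoc)
    from has_vector_derivative_real_field[OF this]
    show "(F has_vector_derivative iexp (- (t * x))) (at x within {a..b})"
      unfolding F_def .
  qed (intro continuous_intros)
  also have "\<dots> = (iexp (- (t * a)) - iexp (- (t * b))) / (\<i> * t)"
    by (simp add: F_def diff_divide_distrib mult.assoc)
  finally show ?thesis .
qed

context real_distribution
begin

text \<open>The inversion kernel is bounded by \<open>b - a\<close>, so with an integrable
  characteristic function the limit of truncated integrals is an absolutely convergent integral.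
  Writing the kernel as an integral over \<open>{a..b}\<close> and exchanging the integrals gives
  the formula.\<close>

lemma measure_Ioc_eq_integral_char:
  fixes a b :: real
  assumes ab: "a \<le> b" and atoms: "measure M {a} = 0" "measure M {b} = 0"
    and int: "integrable lborel (char M)"
  shows "of_real (measure M {a<..b}) =
    1 / (2 * pi) * (CLBINT x. indicator {a..b} x *\<^sub>R (CLBINT t. iexp (- (t * x)) * char M t))"
proof -
  \<comment> \<open>At \<open>t = 0\<close> division by zero gives \<open>F 0 = 0\<close> instead of
    the continuous value \<open>b - a\<close>; one point does not affect the integrals.\<close>
  define F where "F = (\<lambda>t. (iexp (- (t * a)) - iexp (- (t * b))) / (\<i> * of_real t))"
  have [measurable]: "F \<in> borel_measurable borel" unfolding F_def by measurable
  have Fb: "norm (F t) \<le> b - a" for t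
  proof (cases "t = 0")
    case True
    thus ?thesis using ab by (simp add: F_def)
  next
    case False
    \<comment> \<open>The library bound has the opposite sign in the exponent, hence its use at
      \<open>- t\<close>.\<close>
    have "F t = (iexp ((- t) * b) - iexp ((- t) * a)) / (\<i> * of_real (- t))"
      using False by (simp add: F_def field_simps)
    thus ?thesis using Levy_Inversion_aux2[OF ab, of "- t"] False by simp
  qed
  have lim: "(\<lambda>T::nat. CLBINT t=- ereal (real T)..ereal (real T). F t * char M t) \<longlonglongrightarrow> (CLBINT t. F t * char M t)"
  proof -
    have eq: "(CLBINT t=- ereal (real T)..ereal (real T). F t * char M t) = (CLBINT t. indicator {-real T<..<real T} t *\<^sub>R (F t * char M t))" for T :: nat
      by (simp add: interval_lebesgue_integral_def set_lebesgue_integral_def)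
    show ?thesis unfolding eq
    proof (rule integral_dominated_convergence[where w = "\<lambda>t. (b - a) * norm (char M t)"])
      show "integrable lborel (\<lambda>t. (b - a) * cmod (char M t))" using int by simp
      show "AE t in lborel. (\<lambda>T. indicator {-real T<..<real T} t *\<^sub>R (F t * char M t)) \<longlonglongrightarrow> F t * char M t"
      proof (rule AE_I2)
        fix t :: real
        have "eventually (\<lambda>T. real T > \<bar>t\<bar>) sequentially" by real_asymp
        hence "eventually (\<lambda>T. indicator {-real T<..<real T} t *\<^sub>R (F t * char M t) = F t * char M t) sequentially"
          by eventually_elim (auto simp: indicator_def)
        thus "(\<lambda>T. indicator {-real T<..<real T} t *\<^sub>R (F t * char M t)) \<longlonglongrightarrow> F t * char M t"
          by (rule tendsto_eventually)
      qed
      show "AE t in lborel. norm (indicator {-real T<..<real T} t *\<^sub>R (F t * char M t)) \<le> (b - a) * cmod (char M t)" for T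
        using ab Fb by (auto simp: norm_mult indicator_def intro!: mult_right_mono)
    qed measurable
  qed
  have "of_real (measure M {a<..b}) = 1 / (2 * pi) * (CLBINT t. F t * char M t)"
    by (rule LIMSEQ_unique[OF Levy_Inversion[OF ab atoms]])
       (use lim in \<open>auto simp: F_def intro!: tendsto_intros\<close>)
  also have "(CLBINT t. F t * char M t) =
      (CLBINT t. (CLBINT x. indicator {a..b} x *\<^sub>R iexp (- (t * x))) * char M t)"
  proof (rule integral_cong_AE)
    show "AE t in lborel. F t * char M t = (CLBINT x. indicator {a..b} x *\<^sub>R iexp (- (t * x))) * char M t"
      using AE_lborel_singleton[of 0] by eventually_elim (simp only: F_def integral_iexp_Icc[OF ab] not_False_eq_True)
  qed measurable
  also have "\<dots> = (CLBINT t. (CLBINT x. indicator {a..b} x *\<^sub>R iexp (- (t * x)) * char M t))"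
    by (simp only: integral_mult_left_zero)
  also have "\<dots> = (CLBINT x. (CLBINT t. indicator {a..b} x *\<^sub>R iexp (- (t * x)) * char M t))"
  proof (rule lborel_pair.Fubini_integral)
    show "integrable (lborel \<Otimes>\<^sub>M lborel) (\<lambda>(x, t). indicator {a..b} x *\<^sub>R iexp (- (t * x)) * char M t)"
    proof (rule lborel_pair.Fubini_integrable)
      have eq: "(LBINT t. norm (case (x, t) of (x, t) \<Rightarrow> indicator {a..b} x *\<^sub>R iexp (- (t * x)) * char M t)) =
        indicator {a..b} x *\<^sub>R (LBINT t. norm (char M t))" for x
        by (simp add: norm_mult indicator_def)
      have "integrable lborel (\<lambda>x. indicator {a..b} x *\<^sub>R (LBINT t. norm (char M t)))"
        by (intro borel_integrable_compact) auto
      thus "integrable lborel (\<lambda>x. LBINT t. norm (case (x, t) of (x, t) \<Rightarrow> indicator {a..b} x *\<^sub>R iexp (- (t * x)) * char M t))"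
        unfolding eq .
      show "AE x in lborel. integrable lborel (\<lambda>t. case (x, t) of (x, t) \<Rightarrow> indicator {a..b} x *\<^sub>R iexp (- (t * x)) * char M t)"
      proof (rule AE_I2)
        fix x :: real
        show "integrable lborel (\<lambda>t. case (x, t) of (x, t) \<Rightarrow> indicator {a..b} x *\<^sub>R iexp (- (t * x)) * char M t)"
          by (rule Bochner_Integration.integrable_bound[OF int]) (auto simp: norm_mult indicator_def)
      qed
    qed measurable
  qed
  also have "(CLBINT x. (CLBINT t. indicator {a..b} x *\<^sub>R iexp (- (t * x)) * char M t)) =
     (CLBINT x. indicator {a..b} x *\<^sub>R (CLBINT t. iexp (- (t * x)) * char M t))"
    by (simp only: mult_scaleR_left integral_scaleR_right)
  finally show ?thesis .
qed

text \<open>The candidate \<open>g\<close> is bounded and continuous. Inversion gives the measure of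
  intervals with null endpoints; boundedness of \<open>g\<close> rules out atoms, which frees the
  endpoints. Continuity then forces \<open>g \<ge> 0\<close>, and half-lines identify the
  measure.\<close>

lemma density_of_integrable_char:
  assumes int: "integrable lborel (char M)"
  defines "g \<equiv> (\<lambda>x. Re (1 / (2 * pi) * (CLBINT t. iexp (- (t * x)) * char M t)))"
  shows "g x \<ge> 0" and "M = density lborel (\<lambda>x. ennreal (g x))"
proof -
  define K where "K = (\<lambda>x. CLBINT t. iexp (- (t * x)) * char M t)"
  define C where "C = (LBINT t. norm (char M t)) / (2 * pi)"
  have gK: "g x = Re (K x) / (2 * pi)" for x
    by (simp add: g_def K_def Re_divide_of_real flip: of_real_mult)
  have K_cont: "isCont K x" for x unfolding K_def by (rule isCont_fourier[OF int])
  have g_cont: "isCont g x" for x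
    unfolding gK[abs_def] by (intro isCont_divide isCont_Re K_cont continuous_const) auto
  have [measurable]: "g \<in> borel_measurable borel" "K \<in> borel_measurable borel"
    by (auto intro!: borel_measurable_continuous_onI continuous_at_imp_continuous_on g_cont K_cont)
  have g_le: "\<bar>g x\<bar> \<le> C" for x
    unfolding gK C_def abs_divide
    using order_trans[OF abs_Re_le_cmod norm_fourier_le[of x "char M"]]
    by (simp add: K_def divide_right_mono)
  have C: "C \<ge> 0" by (simp add: C_def)
  have int_g: "integrable lborel (\<lambda>x. indicator {a..b} x *\<^sub>R g x)" for a b
    by (intro borel_integrable_compact continuous_at_imp_continuous_on) (auto intro: g_cont)
  have int_K: "integrable lborel (\<lambda>x. indicator {a..b} x *\<^sub>R K x)" for a b
    by (intro borel_integrable_compact continuous_at_imp_continuous_on) (auto intro: K_cont)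
  have int_const: "integrable lborel (\<lambda>x. indicator {a..b} x *\<^sub>R k)" for a b k :: real
    by (intro borel_integrable_compact) auto
  have eq0: "measure M {a<..b} = (LBINT x. indicator {a..b} x *\<^sub>R g x)"
    if "a \<le> b" "measure M {a} = 0" "measure M {b} = 0" for a b
  proof -
    have "measure M {a<..b} = Re (of_real (measure M {a<..b}))" by simp
    also have "\<dots> = Re (CLBINT x. indicator {a..b} x *\<^sub>R K x) / (2 * pi)"
      by (subst measure_Ioc_eq_integral_char[OF that int])
         (simp add: K_def Re_divide_of_real flip: of_real_mult)
    also have "Re (CLBINT x. indicator {a..b} x *\<^sub>R K x) = (LBINT x. Re (indicator {a..b} x *\<^sub>R K x))"
      by (rule integral_Re[OF int_K, symmetric])
    also have "\<dots> / (2 * pi) = (LBINT x. indicator {a..b} x *\<^sub>R g x)"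
      by (simp add: gK)
    finally show ?thesis .
  qed
  \<comment> \<open>The atoms are countable, so every nonempty open interval contains a point that
    is not one.\<close>
  have nonatom: "\<exists>y. u < y \<and> y < v \<and> measure M {y} = 0" if "u < v" for u v
    using open_minus_countable[OF countable_atoms, of "{u<..<v}"] that
    by (auto simp: zero_less_measure_iff not_less intro: antisym)
  have le0: "measure M {a<..b} \<le> C * (b - a)"
    if "a \<le> b" "measure M {a} = 0" "measure M {b} = 0" for a b
  proof -
    have "measure M {a<..b} = (LBINT x. indicator {a..b} x *\<^sub>R g x)" by (rule eq0[OF that])
    also have "\<dots> \<le> (LBINT x. indicator {a..b} x *\<^sub>R C)"
      by (intro integral_mono int_g int_const) (use g_le in \<open>auto simp: indicator_def abs_le_iff\<close>)
    also have "\<dots> = C * (b - a)" using that(1) by simp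
    finally show ?thesis .
  qed
  \<comment> \<open>Levy inversion only sees intervals with null endpoints; the bounded density excludes atoms.\<close>
  have no_atom: "measure M {y} = 0" for y
  proof -
    have "measure M {y} \<le> 0 + \<epsilon>" if \<epsilon>: "\<epsilon> > 0" for \<epsilon>
    proof -
      \<comment> \<open>Adding 1 keeps the divisor positive when \<open>C = 0\<close>;
        \<open>\<delta>\<close> is chosen so that an interval of length \<open>2 * \<delta>\<close>
        has bound \<open>D * (2 * \<delta>) = \<epsilon>\<close>.\<close>
      define D where "D = C + 1"
      define \<delta> where "\<delta> = \<epsilon> / (2 * D)"
      have D: "D > 0" "C \<le> D" using C by (auto simp: D_def)
      have \<delta>: "\<delta> > 0" using \<epsilon> D by (simp add: \<delta>_def)
      obtain u v where uv: "y - \<delta> < u" "u < y" "y < v" "v < y + \<delta>" "measure M {u} = 0" "measure M {v} = 0"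
        using nonatom[of "y - \<delta>" y] nonatom[of y "y + \<delta>"] \<delta> by auto
      have "measure M {y} \<le> measure M {u<..v}"
        using uv by (intro finite_measure_mono) auto
      also have "\<dots> \<le> C * (v - u)" using uv by (intro le0) auto
      also have "\<dots> \<le> D * (2 * \<delta>)" using uv D by (intro mult_mono) auto
      also have "\<dots> = \<epsilon>" using D by (simp add: \<delta>_def)
      finally show ?thesis by simp
    qed
    hence "measure M {y} \<le> 0" by (rule field_le_epsilon)
    thus ?thesis using measure_nonneg[of M "{y}"] by linarith
  qed
  note eq = eq0[OF _ no_atom no_atom]
  show nonneg: "g x \<ge> 0" for x
  proof (rule ccontr)
    assume "\<not> g x \<ge> 0"
    hence neg: "g x < 0" by simp
    \<comment> \<open>By continuity a negative value would persist on an interval, whose measure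
      would then be negative.\<close>
    have "eventually (\<lambda>y. g y < g x / 2) (nhds x)"
      using g_cont[of x] neg by (intro order_tendstoD(2)) (auto simp: isCont_def tendsto_nhds_iff)
    then obtain \<delta> where \<delta>: "\<delta> > 0" "\<And>y. dist y x < \<delta> \<Longrightarrow> g y < g x / 2"
      by (auto simp: eventually_nhds_metric)
    have "0 \<le> measure M {x<..x + \<delta> / 2}" by simp
    also have "\<dots> = (LBINT y. indicator {x..x + \<delta> / 2} y *\<^sub>R g y)"
      using \<delta> by (intro eq) auto
    also have "\<dots> \<le> (LBINT y. indicator {x..x + \<delta> / 2} y *\<^sub>R (g x / 2))"
    proof (rule integral_mono[OF int_g])
      fix y
      show "integrable lborel (\<lambda>y. indicator {x..x + \<delta> / 2} y *\<^sub>R (g x / 2))" by (rule int_const)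
      show "indicator {x..x + \<delta> / 2} y *\<^sub>R g y \<le> indicator {x..x + \<delta> / 2} y *\<^sub>R (g x / 2)"
        using \<delta>(1) \<delta>(2)[of y] by (auto simp: indicator_def dist_real_def intro: less_imp_le)
    qed
    also have "\<dots> = (g x / 2) * (\<delta> / 2)" using \<delta> by simp
    also have "\<dots> < 0" using neg \<delta> by (simp add: mult_neg_pos)
    finally show False by simp
  qed
  let ?N = "density lborel (\<lambda>x. ennreal (g x))"
  have Ioc: "emeasure ?N {a<..b} = emeasure M {a<..b}" if "a \<le> b" for a b
  proof -
    have "emeasure ?N {a<..b} = (\<integral>\<^sup>+x. ennreal (g x) * indicator {a<..b} x \<partial>lborel)"
      by (subst emeasure_density) auto
    \<comment> \<open>The half-open and the closed interval differ by the null set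
      \<open>{a}\<close>.\<close>
    also have "\<dots> = (\<integral>\<^sup>+x. ennreal (indicator {a..b} x *\<^sub>R g x) \<partial>lborel)"
      by (rule nn_integral_cong_AE, rule AE_I[of _ _ "{a}"]) (auto simp: indicator_def split: if_splits)
    also have "\<dots> = ennreal (LBINT x. indicator {a..b} x *\<^sub>R g x)"
      by (rule nn_integral_eq_integral[OF int_g]) (simp add: nonneg)
    also have "\<dots> = emeasure M {a<..b}"
      using eq[OF that] by (simp add: emeasure_eq_measure)
    finally show ?thesis .
  qed
  show "M = ?N"
  proof (rule measure_eqI_lessThan)
    fix y
    show "emeasure M {y<..} < \<infinity>" by (simp add: less_top[symmetric])
    have U: "{y<..} = (\<Union>n. {y<..y + real n})"
      using real_arch_simple[of "_ - y"] by (auto simp: algebra_simps)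
    have inc: "incseq (\<lambda>n. {y<..y + real n})" by (auto simp: incseq_def)
    have "emeasure M {y<..} = (SUP n. emeasure M {y<..y + real n})"
      unfolding U using inc by (intro SUP_emeasure_incseq[symmetric]) auto
    also have "\<dots> = (SUP n. emeasure ?N {y<..y + real n})" by (simp add: Ioc)
    also have "\<dots> = emeasure ?N {y<..}"
      unfolding U using inc by (intro SUP_emeasure_incseq) auto
    finally show "emeasure M {y<..} = emeasure ?N {y<..}" .
  qed auto
qed

end

subsection \<open>The powers of the Gamma ratio\<close>

lemma integrable_Cauchy_kernel: "\<beta> > 0 \<Longrightarrow> integrable lborel (\<lambda>t::real. 1 / (1 + (t / \<beta>)\<^sup>2))"
  using lborel_integrable_real_affine_iff[of "1 / \<beta>" "\<lambda>t. inverse (1 + t\<^sup>2)" 0] integrable_inverse_1_plus_square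
  by (simp add: set_integrable_def divide_inverse mult.commute)

context
  fixes a b c :: real
  assumes abc: "a > 0" "b > 0" "c > 0"
begin

text \<open>The poles in \<open>z\<close> of \<open>\<Gamma>(b - a z)\<close>.\<close>
definition pole :: "nat \<Rightarrow> real" where
  "pole k = (b + real k) / a"

text \<open>The quotient of Euler's \<open>n\<close>-th approximations to \<Gamma>(b - a z) and
  \<Gamma>(b), raised to the power \<open>c\<close>. Read as a Laplace transform, the exponential is
  a point mass and the product stands for \<open>n + 1\<close> scaled gamma laws, one for each pole
  from \<open>k = 0\<close> to \<open>n\<close>.\<close>

definition Phi_approx :: "nat \<Rightarrow> complex \<Rightarrow> complex" where
  "Phi_approx n z = exp (z * of_real (- c * a * ln (real n))) *
     (\<Prod>k<Suc n. (1 - z / of_real (pole k)) powr (- of_real c))"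

lemma pole_ge: "pole k \<ge> b / a"
  using abc by (simp add: pole_def divide_right_mono)

lemma pole_pos: "pole k > 0"
  using abc by (simp add: pole_def)

lemma pole_mono: "k \<le> l \<Longrightarrow> pole k \<le> pole l"
  using abc by (simp add: pole_def divide_right_mono)

text \<open>Subtract the two logarithmic series term by term. Each divisor is a positive real, so a
  difference of principal logarithms is the principal logarithm of the quotient and no branch
  correction by a multiple of \<open>2 * pi * \<i>\<close> arises.\<close>

lemma Phi_approx_eq:
  assumes z: "\<bar>Re z\<bar> < b / a" and n: "n > 0"
  shows "Phi_approx n z =
    exp (of_real c * (ln_Gamma_series (of_real b - of_real a * z) n - ln_Gamma_series (of_real b) n))"
proof -
  define w where "w = of_real b - of_real a * z"
  have Re_w: "Re w > 0"
  proof -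
    have "a * Re z \<le> a * \<bar>Re z\<bar>" using abc by simp
    also have "\<dots> < b" using z abc by (simp add: field_simps)
    finally show ?thesis by (simp add: w_def)
  qed
  have w_ne: "w + of_nat k \<noteq> 0" for k
    using Re_w by (auto simp: complex_eq_iff)
  have bk: "complex_of_real (b + real k) \<noteq> 0" for k
    using abc by (simp only: of_real_eq_0_iff)
  have q: "1 - z / of_real (pole k) = (w + of_nat k) / of_real (b + real k)" for k
    using abc bk[of k] by (simp add: pole_def w_def field_simps)
  have q_ne: "1 - z / of_real (pole k) \<noteq> 0" for k
    unfolding q using w_ne bk by (simp only: divide_eq_0_iff simp_thms)
  \<comment> \<open>The factor \<open>k = 0\<close> comes from the isolated term \<open>Ln w\<close>
    of the series; the sum in \<open>ln_Gamma_series\<close> supplies \<open>k = 1\<close> to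
    \<open>n\<close>.\<close>
  have L0: "Ln w - Ln (of_real b) = Ln (1 - z / of_real (pole 0))"
    using Ln_divide_of_real[of b w] w_ne[of 0] abc unfolding q by (simp add: Ln_of_real)
  have Lk: "Ln (w / of_nat k + 1) - Ln (of_real b / of_nat k + 1) = Ln (1 - z / of_real (pole k))"
    if "k \<in> {1..n}" for k
  proof -
    have k: "real k > 0" using that by simp
    have pos: "b / real k + 1 > 0" using abc k by (simp add: add_pos_pos)
    have "w / of_nat k + 1 = (w + of_nat k) / of_nat k" using k by (simp add: field_simps)
    hence ne: "w / of_nat k + 1 \<noteq> 0" using w_ne[of k] k by simp
    have e: "complex_of_real b / of_nat k + 1 = of_real (b / real k + 1)" by simp
    have "Ln (w / of_nat k + 1) - Ln (of_real b / of_nat k + 1) = Ln ((w / of_nat k + 1) / of_real (b / real k + 1))"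
      unfolding e Ln_divide_of_real[OF pos ne] Ln_of_real[OF pos] ..
    also have "(w / of_nat k + 1) / of_real (b / real k + 1) = (w + of_nat k) / of_real (b + real k)"
    proof -
      have "w / of_nat k + 1 = (w + of_nat k) / of_nat k"
        "complex_of_real (b / real k + 1) = of_real (b + real k) / of_nat k"
        using k by (simp_all add: field_simps)
      thus ?thesis using k by simp
    qed
    finally show ?thesis by (simp add: q)
  qed
  have "ln_Gamma_series w n - ln_Gamma_series (of_real b) n =
     (w - of_real b) * ln (of_nat n) - (Ln w - Ln (of_real b)) -
     (\<Sum>k=1..n. Ln (w / of_nat k + 1) - Ln (of_real b / of_nat k + 1))"
    unfolding ln_Gamma_series_def sum_subtractf by (simp add: algebra_simps)
  also have "(\<Sum>k=1..n. Ln (w / of_nat k + 1) - Ln (of_real b / of_nat k + 1)) =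
     (\<Sum>k=1..n. Ln (1 - z / of_real (pole k)))"
    by (rule sum.cong[OF refl Lk])
  also have "(w - of_real b) * ln (of_nat n) - (Ln w - Ln (of_real b)) - \<dots> =
      - of_real a * z * of_real (ln (real n)) - (\<Sum>k<Suc n. Ln (1 - z / of_real (pole k)))"
  proof -
    have "(\<Sum>k<Suc n. Ln (1 - z / of_real (pole k))) =
        Ln (1 - z / of_real (pole 0)) + (\<Sum>k=1..n. Ln (1 - z / of_real (pole k)))"
      unfolding lessThan_Suc_atMost atMost_atLeast0
      by (subst sum.atLeast_Suc_atMost) simp_all
    moreover have "Ln (of_nat n) = of_real (ln (real n))"
      using n Ln_of_real[of "real n"] by simp
    ultimately show ?thesis unfolding L0 by (simp add: w_def)
  qed
  finally have "of_real c * (ln_Gamma_series w n - ln_Gamma_series (of_real b) n) =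
      z * of_real (- c * a * ln (real n)) + (\<Sum>k<Suc n. - of_real c * Ln (1 - z / of_real (pole k)))"
    by (simp only: sum_distrib_left[symmetric]) (simp add: algebra_simps)
  hence "exp (of_real c * (ln_Gamma_series w n - ln_Gamma_series (of_real b) n)) =
      exp (z * of_real (- c * a * ln (real n))) * (\<Prod>k<Suc n. exp (- of_real c * Ln (1 - z / of_real (pole k))))"
    by (simp only: exp_add exp_sum finite_lessThan)
  also have "(\<Prod>k<Suc n. exp (- of_real c * Ln (1 - z / of_real (pole k)))) =
      (\<Prod>k<Suc n. (1 - z / of_real (pole k)) powr (- of_real c))"
    by (rule prod.cong) (use q_ne in \<open>auto simp: powr_def\<close>)
  finally show ?thesis by (simp add: Phi_approx_def w_def)
qed

text \<open>\<open>ln_Gamma_series\<close> converges to \<open>ln_Gamma\<close> itself, so the limit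
  carries the branch used in \<open>Gamma_ratio_power\<close>.\<close>

lemma Phi_approx_LIMSEQ:
  assumes z: "\<bar>Re z\<bar> < b / a"
  shows "(\<lambda>n. Phi_approx n z) \<longlonglongrightarrow> Gamma_ratio_power c b (of_real b - of_real a * z)"
proof -
  let ?w = "of_real b - of_real a * z"
  have "a * Re z \<le> a * \<bar>Re z\<bar>" using abc by simp
  also have "\<dots> < b" using z abc by (simp add: field_simps)
  finally have "Re ?w > 0" by simp
  hence 1: "?w \<notin> \<int>\<^sub>\<le>\<^sub>0" by (auto elim!: nonpos_Ints_cases simp: complex_eq_iff)
  have 2: "complex_of_real b \<notin> \<int>\<^sub>\<le>\<^sub>0" using abc by (auto elim!: nonpos_Ints_cases simp: complex_eq_iff)
  have "(\<lambda>n. exp (of_real c * (ln_Gamma_series ?w n - ln_Gamma_series (of_real b) n)))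
      \<longlonglongrightarrow> exp (of_real c * (ln_Gamma ?w - ln_Gamma (of_real b)))"
    by (intro tendsto_intros ln_Gamma_complex_LIMSEQ 1 2)
  also have "exp (of_real c * (ln_Gamma ?w - ln_Gamma (of_real b))) = Gamma_ratio_power c b ?w"
    by (simp add: Gamma_ratio_power_def right_diff_distrib)
  finally show ?thesis
  proof (rule Lim_transform_eventually)
    show "eventually (\<lambda>n. exp (of_real c * (ln_Gamma_series ?w n - ln_Gamma_series (of_real b) n)) = Phi_approx n z) sequentially"
      using eventually_gt_at_top[of 0] by eventually_elim (simp add: Phi_approx_eq[OF z])
  qed
qed

section \<open>Decay of the characteristic function\<close>

lemma norm_factor:
  "norm ((1 - \<i> * of_real t / of_real (pole k)) powr (- of_real c)) = (1 + (t / pole k)\<^sup>2) powr (- c / 2)"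
proof -
  let ?u = "1 - \<i> * of_real t / of_real (pole k)"
  have ne: "?u \<noteq> 0" by (auto simp: complex_eq_iff)
  have n: "norm ?u = sqrt (1 + (t / pole k)\<^sup>2)"
    by (simp add: cmod_def)
  have p: "1 + (t / pole k)\<^sup>2 > 0" by (simp add: add_pos_nonneg)
  have "norm (?u powr (- of_real c)) = exp (- c * ln (norm ?u))"
    using ne by (simp add: powr_def norm_exp_eq_Re)
  also have "\<dots> = (1 + (t / pole k)\<^sup>2) powr (- c / 2)"
    using p unfolding n by (simp add: powr_def ln_sqrt)
  finally show ?thesis .
qed

text \<open>All factors have modulus at most 1, so those beyond \<open>N\<close> may be dropped. The
  factor of the largest remaining pole has the largest modulus, so the other factors up to
  \<open>N\<close> are replaced by it. This gives the exponent
  \<open>- c * (N + 1) / 2 \<le> -1\<close>, an integrable majorant uniform in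
  \<open>n\<close>.\<close>

lemma norm_Phi_le:
  assumes N: "c * real (Suc N) \<ge> 2"
  shows "norm (Gamma_ratio_power c b (of_real b - of_real a * (\<i> * of_real t))) \<le> 1 / (1 + (t / pole N)\<^sup>2)"
proof (rule LIMSEQ_le_const2)
  show "(\<lambda>n. norm (Phi_approx n (\<i> * of_real t))) \<longlonglongrightarrow>
      norm (Gamma_ratio_power c b (of_real b - of_real a * (\<i> * of_real t)))"
    using abc by (intro tendsto_norm Phi_approx_LIMSEQ) simp
  have "norm (Phi_approx n (\<i> * of_real t)) \<le> 1 / (1 + (t / pole N)\<^sup>2)" if n: "n \<ge> N" for n
  proof -
    have f1: "(1 + (t / pole k)\<^sup>2) powr (- c / 2) \<le> 1" for k
      using abc powr_mono[of "- c / 2" 0 "1 + (t / pole k)\<^sup>2"] by (simp split: if_splits)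
    have f2: "(1 + (t / pole k)\<^sup>2) powr (- c / 2) \<le> (1 + (t / pole N)\<^sup>2) powr (- c / 2)" if "k \<le> N" for k
    proof (rule powr_mono2')
      have "(t / pole N)\<^sup>2 \<le> (t / pole k)\<^sup>2"
        using pole_mono[OF that] pole_pos[of k] pole_pos[of N]
        by (simp add: power_divide frac_le)
      thus "1 + (t / pole N)\<^sup>2 \<le> 1 + (t / pole k)\<^sup>2" by simp
    qed (use abc in \<open>auto simp: add_pos_nonneg\<close>)
    have "norm (Phi_approx n (\<i> * of_real t)) = (\<Prod>k<Suc n. (1 + (t / pole k)\<^sup>2) powr (- c / 2))"
      unfolding Phi_approx_def norm_mult prod_norm[symmetric] norm_factor
      by (simp add: norm_exp_eq_Re)
    also have "\<dots> \<le> (\<Prod>k<Suc N. (1 + (t / pole k)\<^sup>2) powr (- c / 2))"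
    proof -
      have "(\<Prod>k<Suc n. (1 + (t / pole k)\<^sup>2) powr (- c / 2)) =
          (\<Prod>k\<in>{..<Suc n} - {..<Suc N}. (1 + (t / pole k)\<^sup>2) powr (- c / 2)) *
          (\<Prod>k<Suc N. (1 + (t / pole k)\<^sup>2) powr (- c / 2))"
        by (rule prod.subset_diff) (use n in auto)
      also have "\<dots> \<le> 1 * (\<Prod>k<Suc N. (1 + (t / pole k)\<^sup>2) powr (- c / 2))"
        by (intro mult_right_mono prod_le_1 prod_nonneg) (use f1 in auto)
      finally show ?thesis by simp
    qed
    also have "\<dots> \<le> (\<Prod>k<Suc N. (1 + (t / pole N)\<^sup>2) powr (- c / 2))"
      by (intro prod_mono conjI f2) auto
    also have "\<dots> = (1 + (t / pole N)\<^sup>2) powr (- (c * real (Suc N) / 2))"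
    proof -
      define y where "y = 1 + (t / pole N)\<^sup>2"
      have "y > 0" by (simp add: y_def add_pos_nonneg)
      hence "(y powr (- c / 2)) ^ Suc N = (y powr (- c / 2)) powr real (Suc N)"
        by (intro powr_realpow[symmetric]) simp
      thus ?thesis by (simp add: powr_powr y_def[symmetric] del: power_Suc)
    qed
    also have "\<dots> \<le> (1 + (t / pole N)\<^sup>2) powr (-1)"
      using N by (intro powr_mono) auto
    also have "\<dots> = 1 / (1 + (t / pole N)\<^sup>2)"
      by (simp add: powr_minus_divide add_pos_nonneg)
    finally show ?thesis .
  qed
  thus "\<exists>N'. \<forall>n\<ge>N'. norm (Phi_approx n (\<i> * of_real t)) \<le> 1 / (1 + (t / pole N)\<^sup>2)" by blast
qed

text \<open>Each \<open>Phi_approx n\<close> is the transform of a law on the strip up to the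
  nearest pole, \<open>pole 0 = b / a\<close>; the law sought is a weak limit of these.\<close>

lemma ex_distribution:
  obtains M where "real_distribution M" "exp_moments M (b / a)"
    "\<And>t. char M t = Gamma_ratio_power c b (of_real b - of_real a * (\<i> * of_real t))"
proof -
  have r: "b / a > 0" using abc by simp
  have "\<exists>M. has_laplace M (b / a) (Phi_approx n)" for n
    unfolding Phi_approx_def[abs_def] by (rule ex_has_laplace_prod[OF abc(3) r pole_ge])
  then obtain M where M: "\<And>n. has_laplace (M n) (b / a) (Phi_approx n)" by metis
  show ?thesis
  proof (rule laplace_limit[of M "b / a" "\<lambda>z. Gamma_ratio_power c b (of_real b - of_real a * z)"])
    show "(\<lambda>n. laplace (M n) z) \<longlonglongrightarrow> Gamma_ratio_power c b (of_real b - of_real a * z)"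
      if "\<bar>Re z\<bar> < b / a" for z
      using Phi_approx_LIMSEQ[OF that] that by (simp add: has_laplaceD(3)[OF M])
  qed (use M r that in \<open>auto dest: has_laplaceD(1,2)\<close>)
qed

text \<open>At \<open>exp (- x)\<close> the power in \<open>e_integral\<close> equals
  \<open>exp x\<close> times the Fourier kernel, and this \<open>exp x\<close> cancels the factor
  \<open>exp (- x)\<close> of \<open>g_dens\<close>. What remains is the Fourier inversion
  integral.\<close>

lemma g_dens_eq:
  assumes "\<And>t. char M t = Gamma_ratio_power c b (of_real b - of_real a * (\<i> * of_real t))"
  shows "g_dens c a b x = Re (1 / (2 * pi) * (CLBINT t. iexp (- (t * x)) * char M t))"
proof -
  have "of_real (exp (- x)) powr (\<i> * of_real t - 1) = of_real (exp x) * iexp (- (t * x))" for t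
  proof -
    have "Ln (of_real (exp (- x))) = of_real (- x)" by (subst Ln_of_real) auto
    thus ?thesis by (simp add: powr_def algebra_simps exp_diff exp_minus exp_of_real divide_inverse)
  qed
  hence "e_integral c a b (exp (- x)) =
      1 / (2 * pi) * (CLBINT t. of_real (exp x) * (iexp (- (t * x)) * char M t))"
    unfolding e_integral_def assms by (simp only: mult.assoc mult.left_commute[of \<i>])
  also have "\<dots> = of_real (exp x) * (1 / (2 * pi) * (CLBINT t. iexp (- (t * x)) * char M t))"
    by (subst integral_mult_right_zero) simp
  finally show ?thesis
    by (simp add: g_dens_def e_dens_def mult.assoc flip: exp_add)
qed

end

theorem theorem4p1:
  fixes a b c :: real
  assumes "a > 0" and "b > 0" and "c > 0"
  shows "(\<forall>x. 0 \<le> g_dens c a b x) \<and>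
         prob_space (density lborel (\<lambda>x. ennreal (g_dens c a b x))) \<and>
         determinate_Hamburger (density lborel (\<lambda>x. ennreal (g_dens c a b x)))"
proof -
  obtain M where M: "real_distribution M" "exp_moments M (b / a)"
    "\<And>t. char M t = Gamma_ratio_power c b (of_real b - of_real a * (\<i> * of_real t))"
    using ex_distribution[OF assms] by blast
  interpret real_distribution M by (rule M)
  \<comment> \<open>A single factor decays only like \<open>\<bar>t\<bar> powr (- c)\<close>, which
    is not integrable for small \<open>c\<close>; \<open>N + 1 \<ge> 2 / c\<close> factors together
    decay quadratically.\<close>
  obtain N where "real (Suc N) \<ge> 2 / c"
    using real_arch_simple[of "2 / c"] by (meson le_SucI of_nat_le_iff order_trans lessI less_imp_le)
  hence N: "c * real (Suc N) \<ge> 2" using assms(3) by (simp add: field_simps)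
  have int: "integrable lborel (char M)"
  proof (rule Bochner_Integration.integrable_bound)
    show "integrable lborel (\<lambda>t. 1 / (1 + (t / pole a b N)\<^sup>2))"
      by (rule integrable_Cauchy_kernel[OF pole_pos[OF assms]])
    show "AE t in lborel. norm (char M t) \<le> norm (1 / (1 + (t / pole a b N)\<^sup>2))"
      using norm_Phi_le[OF assms N] by (auto simp: M(3))
  qed measurable
  have g: "g_dens c a b = (\<lambda>x. Re (1 / (2 * pi) * (CLBINT t. iexp (- (t * x)) * char M t)))"
    by (rule ext) (rule g_dens_eq[OF assms M(3)])
  have dens: "density lborel (\<lambda>x. ennreal (g_dens c a b x)) = M"
    unfolding g by (rule density_of_integrable_char(2)[OF int, symmetric])
  have "0 \<le> g_dens c a b x" for x
    unfolding g by (rule density_of_integrable_char(1)[OF int])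
  moreover have "determinate_Hamburger M"
    using exp_moments_determinate[OF M(2)] assms prob_space_axioms by simp
  ultimately show ?thesis
    unfolding dens using prob_space_axioms by blast
qed

end
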